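(* Let $\Bbbk$ be a field of characteristic $0$, let $V$ be an $n$-dimensional $\Bbbk$-vector space and $V^{2,1}=\mathrm{Hom}(V\otimes V,V)$. Let $\mathrm{Alg}(V)\subset V^{2,1}$ be the associativity locus and $\mathrm{As}(V)\subset V^{2,1}\times V^{2,1}$ the associative bilinear incidence variety. Then $$\mathrm{Alg}(V)=\{x\in V^{2,1} : (x,x)\in \mathrm{As}(V)\}.$$
   Context: Fix a basis $(e_i)_{i=1}^n$ of $V$. Each $x\in V^{2,1}\cong\Bbbk^{n^3}$ has structure constants $x_{i,j}^\ell$ and determines the bilinear product $\mu_x(e_i,e_j)=\sum_{\ell} x_{i,j}^\ell e_\ell$. Let $V^{3,1}=\mathrm{Hom}(V^{\otimes 3},V)$. The associativity locus is $\mathrm{Alg}(V)=\{x\in V^{2,1}:\Phi(x)=0\}$, where $\Phi:V^{2,1}\to V^{3,1}$ is $\Phi(x)(a,b,c)=\mu_x(\mu_x(a,b),c)-\mu_x(a,\mu_x(b,c))$. Define the bilinear map $\beta:V^{2,1}\times V^{2,1}\to V^{3,1}$ by $\beta(x,y)(a,b,c)=\mu_x(\mu_y(a,b),c)-\mu_x(a,\mu_y(b,c))$, so that $\Phi(x)=\beta(x,x)$. For $\varphi\in (V^{3,1})^\vee$ (the dual space) let $q_\varphi$ be the $n^3\times n^3$ matrix over $\Bbbk$ with $\langle\varphi,\beta(x,y)\rangle=x^{t}q_\varphi y$ for all $x,y$, where $x,y$ are viewed as column vectors of structure constants. Let $Q_{\mathrm{As}}$ be the linear span of all $q_\varphi$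 and $Q_{\mathrm{As}}^{\mathrm{sym}}=\mathrm{span}\{\tfrac12(q+q^{t}):q\in Q_{\mathrm{As}}\}$. The incidence variety is $$\mathrm{As}(V)=\{(x,y)\in V^{2,1}\times V^{2,1}: x^{t}qy=0\text{ for all }q\in Q_{\mathrm{As}}^{\mathrm{sym}}\}.$$ *)

theory Defs
  imports "Jordan_Normal_Form.VS_Connect"
begin

text \<open>
  The space \<open>V\<close> is the type \<open>'v\<close> with scalar multiplication \<open>scale\<close>, and \<open>e 0, \<dots>, e (n - 1)\<close> is
  the chosen basis; \<open>n = 0\<close> is allowed.
\<close>

locale based_vector_space = vector_space scale
  for scale :: "'k::field_char_0 \<Rightarrow> 'v::ab_group_add \<Rightarrow> 'v"  (infixr \<open>*s\<close> 75) +
  fixes n :: nat and e :: "nat \<Rightarrow> 'v"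
  assumes inj_e: "inj_on e {..<n}"
    and independent_e: "independent (e ` {..<n})"
    and span_e: "span (e ` {..<n}) = UNIV"
begin

text \<open>
  By the universal property of the tensor product, \<open>Hom(V \<otimes> V, V)\<close> and \<open>Hom(V \<otimes> V \<otimes> V, V)\<close> are
  the spaces of bilinear and trilinear maps, so that \<open>x\<close> itself is the product \<open>\<mu>\<^sub>x\<close>.
\<close>

definition V21 :: "('v \<Rightarrow> 'v \<Rightarrow> 'v) set" where
  "V21 = {x. (\<forall>a. Vector_Spaces.linear scale scale (\<lambda>b. x a b)) \<and>
             (\<forall>b. Vector_Spaces.linear scale scale (\<lambda>a. x a b))}"

definition V31 :: "('v \<Rightarrow> 'v \<Rightarrow> 'v \<Rightarrow> 'v) set" where
  "V31 = {t. (\<forall>b c. Vector_Spaces.linear scale scale (\<lambda>a. t a b c)) \<and>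
             (\<forall>a c. Vector_Spaces.linear scale scale (\<lambda>b. t a b c)) \<and>
             (\<forall>a b. Vector_Spaces.linear scale scale (\<lambda>c. t a b c))}"

text \<open>Only the values of a functional on \<^term>\<open>V31\<close> matter; elsewhere it is unconstrained.\<close>

definition V31_dual :: "(('v \<Rightarrow> 'v \<Rightarrow> 'v \<Rightarrow> 'v) \<Rightarrow> 'k) set" where
  "V31_dual = {\<phi>.
     (\<forall>s\<in>V31. \<forall>t\<in>V31. \<phi> (\<lambda>a b c. s a b c + t a b c) = \<phi> s + \<phi> t) \<and>
     (\<forall>r. \<forall>t\<in>V31. \<phi> (\<lambda>a b c. r *s t a b c) = r * \<phi> t)}"

definition \<Phi> :: "('v \<Rightarrow> 'v \<Rightarrow> 'v) \<Rightarrow> 'v \<Rightarrow> 'v \<Rightarrow> 'v \<Rightarrow> 'v" where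
  "\<Phi> x = (\<lambda>a b c. x (x a b) c - x a (x b c))"

definition Alg :: "('v \<Rightarrow> 'v \<Rightarrow> 'v) set" where
  "Alg = {x \<in> V21. \<Phi> x = (\<lambda>a b c. 0)}"

definition \<beta> :: "('v \<Rightarrow> 'v \<Rightarrow> 'v) \<Rightarrow> ('v \<Rightarrow> 'v \<Rightarrow> 'v) \<Rightarrow> 'v \<Rightarrow> 'v \<Rightarrow> 'v \<Rightarrow> 'v" where
  "\<beta> x y = (\<lambda>a b c. x (y a b) c - x a (y b c))"

definition structure_const :: "('v \<Rightarrow> 'v \<Rightarrow> 'v) \<Rightarrow> nat \<Rightarrow> nat \<Rightarrow> nat \<Rightarrow> 'k" where
  "structure_const x i j l = representation (e ` {..<n}) (x (e i) (e j)) (e l)"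

text \<open>
  The triple \<open>(i, j, l)\<close> of indices below \<open>n\<close> is put at position \<open>i * n\<^sup>2 + j * n + l\<close> of the column vector.
\<close>

definition structure_vec :: "('v \<Rightarrow> 'v \<Rightarrow> 'v) \<Rightarrow> 'k vec" where
  "structure_vec x = vec (n ^ 3) (\<lambda>k. structure_const x (k div n ^ 2) (k div n mod n) (k mod n))"

definition represents_form :: "'k mat \<Rightarrow> (('v \<Rightarrow> 'v \<Rightarrow> 'v \<Rightarrow> 'v) \<Rightarrow> 'k) \<Rightarrow> bool" where
  "represents_form q \<phi> \<longleftrightarrow> q \<in> carrier_mat (n ^ 3) (n ^ 3) \<and>
     (\<forall>x\<in>V21. \<forall>y\<in>V21. \<phi> (\<beta> x y) = structure_vec x \<bullet> (q *\<^sub>v structure_vec y))"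

text \<open>For \<open>\<phi>\<close> in \<^term>\<open>V31_dual\<close> the matrix exists and is unique; see \<open>ex1_represents_form\<close> below.\<close>

definition q_mat :: "(('v \<Rightarrow> 'v \<Rightarrow> 'v \<Rightarrow> 'v) \<Rightarrow> 'k) \<Rightarrow> 'k mat" where
  "q_mat \<phi> = (THE q. represents_form q \<phi>)"

definition mat_span :: "'k mat set \<Rightarrow> 'k mat set" where
  "mat_span = LinearCombinations.module.span class_ring (module_mat TYPE('k) (n ^ 3) (n ^ 3))"

definition Q_As :: "'k mat set" where
  "Q_As = mat_span (q_mat ` V31_dual)"

definition Q_As_sym :: "'k mat set" where
  "Q_As_sym = mat_span ((\<lambda>q. (1 / 2) \<cdot>\<^sub>m (q + q\<^sup>T)) ` Q_As)"

definition As :: "(('v \<Rightarrow> 'v \<Rightarrow> 'v) \<times> ('v \<Rightarrow> 'v \<Rightarrow> 'v)) set" where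
  "As = {(x, y) \<in> V21 \<times> V21. \<forall>q\<in>Q_As_sym. structure_vec x \<bullet> (q *\<^sub>v structure_vec y) = 0}"

lemma sum_div_mod:
  fixes m :: nat and g :: "nat \<Rightarrow> nat \<Rightarrow> 'c::comm_monoid_add"
  shows "(\<Sum>k<m * n. g (k div n) (k mod n)) = (\<Sum>i<m. \<Sum>l<n. g i l)"
proof -
  have "(\<Sum>k<m * n. g (k div n) (k mod n)) = (\<Sum>i<m. \<Sum>k\<in>{i * n..<i * n + n}. g (k div n) (k mod n))"
    by (rule sum.nat_group[symmetric])
  also have "\<dots> = (\<Sum>i<m. \<Sum>l<n. g i l)"
  proof (rule sum.cong[OF refl])
    fix i
    have "(\<Sum>k\<in>{i * n..<i * n + n}. g (k div n) (k mod n)) = (\<Sum>l\<in>{0..<n}. g ((l + i * n) div n) ((l + i * n) mod n))"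
      using sum.shift_bounds_nat_ivl[of "\<lambda>k. g (k div n) (k mod n)" 0 "i * n" n] by (simp add: add.commute)
    also have "\<dots> = (\<Sum>l<n. g i l)"
      by (rule sum.cong) auto
    finally show "(\<Sum>k\<in>{i * n..<i * n + n}. g (k div n) (k mod n)) = (\<Sum>l<n. g i l)" .
  qed
  finally show ?thesis .
qed

lemma sum_triple:
  fixes f :: "nat \<Rightarrow> nat \<Rightarrow> nat \<Rightarrow> 'c::comm_monoid_add"
  shows "(\<Sum>k<n ^ 3. f (k div n ^ 2) (k div n mod n) (k mod n)) = (\<Sum>i<n. \<Sum>j<n. \<Sum>l<n. f i j l)"
proof -
  have "(\<Sum>k<n ^ 3. f (k div n ^ 2) (k div n mod n) (k mod n))
      = (\<Sum>k<(n * n) * n. f ((k div n) div n) ((k div n) mod n) (k mod n))"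
    by (simp add: power3_eq_cube power2_eq_square div_mult2_eq)
  also have "\<dots> = (\<Sum>p<n * n. \<Sum>l<n. f (p div n) (p mod n) l)"
    by (rule sum_div_mod[of "\<lambda>p l. f (p div n) (p mod n) l"])
  also have "\<dots> = (\<Sum>i<n. \<Sum>j<n. \<Sum>l<n. f i j l)"
    by (rule sum_div_mod[of "\<lambda>i j. \<Sum>l<n. f i j l"])
  finally show ?thesis .
qed

abbreviation coord :: "'v \<Rightarrow> nat \<Rightarrow> 'k" where
  "coord v i \<equiv> representation (e ` {..<n}) v (e i)"

definition unit_product :: "nat \<Rightarrow> 'v \<Rightarrow> 'v \<Rightarrow> 'v" where
  "unit_product k = (\<lambda>a b. (coord a (k div n ^ 2) * coord b (k div n mod n)) *s e (k mod n))"

lemma linear_iff_scale: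
  "Vector_Spaces.linear scale scale f \<longleftrightarrow> (\<forall>a b. f (a + b) = f a + f b) \<and> (\<forall>r a. f (r *s a) = r *s f a)"
  unfolding Vector_Spaces.linear_def module_hom_def module_hom_axioms_def
  using vector_space_axioms module_axioms by auto

lemma coord_add: "coord (a + b) i = coord a i + coord b i"
  by (simp add: representation_add independent_e span_e)

lemma coord_scale: "coord (r *s a) i = r * coord a i"
  by (simp add: representation_scale independent_e span_e)

lemma coord_basis: "i < n \<Longrightarrow> j < n \<Longrightarrow> coord (e j) i = (if i = j then 1 else 0)"
  using inj_e by (auto simp: representation_basis independent_e inj_on_def)

lemma sum_coord: "(\<Sum>i<n. coord v i *s e i) = v"
proof -
  have "(\<Sum>b\<in>e ` {..<n}. representation (e ` {..<n}) v b *s b) = v"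
    by (rule sum_representation_eq) (auto simp: independent_e span_e)
  then show ?thesis by (simp add: sum.reindex[OF inj_e])
qed

lemma V21_linear:
  assumes "x \<in> V21"
  shows "Vector_Spaces.linear scale scale (\<lambda>b. x a b)" "Vector_Spaces.linear scale scale (\<lambda>a. x a b)"
  using assms by (auto simp: V21_def)

lemma V21_sum:
  assumes "x \<in> V21"
  shows "x (sum f S) b = (\<Sum>i\<in>S. x (f i) b)" "x a (sum f S) = (\<Sum>i\<in>S. x a (f i))"
  using Vector_Spaces.linear.axioms(3)[OF V21_linear(2)[OF assms], THEN module_hom.sum]
    Vector_Spaces.linear.axioms(3)[OF V21_linear(1)[OF assms], THEN module_hom.sum] by auto

lemma V21_simps:
  assumes "x \<in> V21"
  shows "x (a + a') b = x a b + x a' b" "x a (b + b') = x a b + x a b'"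
    "x (r *s a) b = r *s x a b" "x a (r *s b) = r *s x a b"
  using V21_linear[OF assms] by (auto simp: linear_iff_scale)

lemma dim_structure_vec [simp]: "structure_vec x \<in> carrier_vec (n ^ 3)"
  by (simp add: structure_vec_def)

lemma unit_product_V21: "unit_product k \<in> V21"
  by (simp add: V21_def unit_product_def linear_iff_scale coord_add coord_scale algebra_simps)

lemma index_bounds:
  assumes "k < n ^ 3"
  shows "k div n ^ 2 < n" "k div n mod n < n" "k mod n < n"
proof -
  have "0 < n" using assms by (cases n) auto
  then show "k div n mod n < n" "k mod n < n" by auto
  have "k < n * n ^ 2" using assms by (simp add: power3_eq_cube power2_eq_square)
  then show "k div n ^ 2 < n" by (rule less_mult_imp_div_less)
qed

lemma structure_vec_unit_product:
  assumes "k < n ^ 3"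
  shows "structure_vec (unit_product k) = unit_vec (n ^ 3) k"
proof (rule eq_vecI)
  show "dim_vec (structure_vec (unit_product k)) = dim_vec (unit_vec (n ^ 3) k)"
    by (simp add: structure_vec_def)
  fix m assume "m < dim_vec (unit_vec (n ^ 3) k)"
  then have m: "m < n ^ 3" by simp
  note b = index_bounds[OF assms] index_bounds[OF m]
  have enc: "p = (p div n ^ 2 * n + p div n mod n) * n + p mod n" for p
    by (metis div_mult2_eq div_mult_mod_eq power2_eq_square)
  have "m = k \<longleftrightarrow> k div n ^ 2 = m div n ^ 2 \<and> k div n mod n = m div n mod n \<and> k mod n = m mod n"
    using enc[of m] enc[of k] by metis
  then show "structure_vec (unit_product k) $ m = unit_vec (n ^ 3) k $ m"
    using b m assms
    by (auto simp: structure_vec_def structure_const_def unit_product_def coord_scale coord_basis unit_vec_def)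
qed

lemma product_expansion:
  assumes "x \<in> V21"
  shows "x a b = (\<Sum>k<n ^ 3. structure_vec x $ k *s unit_product k a b)"
proof -
  have "x a b = x (\<Sum>i<n. coord a i *s e i) (\<Sum>j<n. coord b j *s e j)"
    by (simp only: sum_coord)
  also have "\<dots> = (\<Sum>i<n. \<Sum>j<n. (coord a i * coord b j) *s x (e i) (e j))"
    by (subst V21_sum(1)[OF assms])
      (simp add: V21_sum(2)[OF assms] V21_simps[OF assms] scale_sum_right mult.commute)
  also have "\<dots> = (\<Sum>i<n. \<Sum>j<n. (coord a i * coord b j) *s (\<Sum>l<n. coord (x (e i) (e j)) l *s e l))"
    by (simp only: sum_coord)
  also have "\<dots> = (\<Sum>i<n. \<Sum>j<n. \<Sum>l<n. structure_const x i j l *s ((coord a i * coord b j) *s e l))"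
    by (simp add: scale_sum_right structure_const_def mult.commute)
  also have "\<dots> = (\<Sum>k<n ^ 3. structure_vec x $ k *s unit_product k a b)"
    by (subst sum_triple[symmetric]) (simp add: structure_vec_def unit_product_def)
  finally show ?thesis .
qed

lemma \<beta>_V31:
  assumes "x \<in> V21" "y \<in> V21"
  shows "\<beta> x y \<in> V31"
  using assms by (simp add: V31_def \<beta>_def linear_iff_scale V21_simps algebra_simps)

lemma dual_sum:
  assumes "\<phi> \<in> V31_dual" "finite S" "\<And>k. k \<in> S \<Longrightarrow> t k \<in> V31"
  shows "(\<lambda>a b c. \<Sum>k\<in>S. r k *s t k a b c) \<in> V31 \<and>
    \<phi> (\<lambda>a b c. \<Sum>k\<in>S. r k *s t k a b c) = (\<Sum>k\<in>S. r k * \<phi> (t k))"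
  using assms(2,3)
proof (induction S rule: finite_induct)
  case empty
  have z: "(\<lambda>a b c. 0) \<in> V31" by (simp add: V31_def linear_iff_scale)
  have sm: "\<phi> (\<lambda>a b c. r *s t a b c) = r * \<phi> t" if "t \<in> V31" for r t
    using assms(1) that by (simp add: V31_dual_def)
  show ?case using z sm[OF z, of 0] by simp
next
  case (insert k S)
  have 1: "(\<lambda>a b c. r k *s t k a b c) \<in> V31"
    using insert.prems[of k] by (simp add: V31_def linear_iff_scale algebra_simps)
  have 2: "(\<lambda>a b c. s a b c + u a b c) \<in> V31" if "s \<in> V31" "u \<in> V31" for s u
    using that by (simp add: V31_def linear_iff_scale algebra_simps)
  have ad: "\<phi> (\<lambda>a b c. s a b c + u a b c) = \<phi> s + \<phi> u" if "s \<in> V31" "u \<in> V31" for s u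
    using assms(1) that by (simp add: V31_dual_def)
  have sm: "\<phi> (\<lambda>a b c. r *s t a b c) = r * \<phi> t" if "t \<in> V31" for r t
    using assms(1) that by (simp add: V31_dual_def)
  have IH: "(\<lambda>a b c. \<Sum>k\<in>S. r k *s t k a b c) \<in> V31"
    "\<phi> (\<lambda>a b c. \<Sum>k\<in>S. r k *s t k a b c) = (\<Sum>k\<in>S. r k * \<phi> (t k))"
    using insert.IH insert.prems by auto
  show ?case
    using 2[OF 1 IH(1)] ad[OF 1 IH(1)] sm[of "t k" "r k"] insert.prems[of k] insert.hyps IH(2)
    by simp
qed

lemma \<beta>_expansion:
  assumes x: "x \<in> V21" and y: "y \<in> V21"
  shows "\<beta> x y = (\<lambda>a b c. \<Sum>p\<in>{..<n ^ 3} \<times> {..<n ^ 3}.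
    (structure_vec x $ fst p * structure_vec y $ snd p) *s \<beta> (unit_product (fst p)) (unit_product (snd p)) a b c)"
proof (intro ext)
  fix a b c
  let ?u = "\<lambda>k. structure_vec x $ k" and ?w = "\<lambda>k. structure_vec y $ k" and ?E = unit_product
  have 1: "x (y a b) c = (\<Sum>k<n ^ 3. \<Sum>m<n ^ 3. (?u k * ?w m) *s ?E k (?E m a b) c)"
    by (subst product_expansion[OF x], subst product_expansion[OF y])
      (simp add: V21_sum[OF unit_product_V21] V21_simps[OF unit_product_V21] scale_sum_right)
  have 2: "x a (y b c) = (\<Sum>k<n ^ 3. \<Sum>m<n ^ 3. (?u k * ?w m) *s ?E k a (?E m b c))"
    by (subst product_expansion[OF x], subst product_expansion[OF y])
      (simp add: V21_sum[OF unit_product_V21] V21_simps[OF unit_product_V21] scale_sum_right)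
  show "\<beta> x y a b c = (\<Sum>p\<in>{..<n ^ 3} \<times> {..<n ^ 3}. (?u (fst p) * ?w (snd p)) *s \<beta> (?E (fst p)) (?E (snd p)) a b c)"
    unfolding \<beta>_def 1 2
    by (simp add: sum.cartesian_product' sum_subtractf scale_right_diff_distrib case_prod_unfold)
qed

lemma ex1_represents_form:
  assumes \<phi>: "\<phi> \<in> V31_dual"
  shows "\<exists>!q. represents_form q \<phi>"
proof -
  let ?q = "mat (n ^ 3) (n ^ 3) (\<lambda>(k, m). \<phi> (\<beta> (unit_product k) (unit_product m)))"
  have "\<phi> (\<beta> x y) = structure_vec x \<bullet> (?q *\<^sub>v structure_vec y)" if x: "x \<in> V21" and y: "y \<in> V21" for x y
  proof -
    have "\<phi> (\<beta> x y) = (\<Sum>p\<in>{..<n ^ 3} \<times> {..<n ^ 3}. (structure_vec x $ fst p * structure_vec y $ snd p)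
        * \<phi> (\<beta> (unit_product (fst p)) (unit_product (snd p))))"
      unfolding \<beta>_expansion[OF x y]
      by (rule conjunct2[OF dual_sum[OF \<phi>]]) (auto simp: \<beta>_V31 unit_product_V21)
    also have "\<dots> = structure_vec x \<bullet> (?q *\<^sub>v structure_vec y)"
      by (simp add: scalar_prod_def sum.cartesian_product' structure_vec_def sum_distrib_left
          atLeast0LessThan mult_ac)
    finally show ?thesis .
  qed
  then have ex: "represents_form ?q \<phi>" by (simp add: represents_form_def)
  have "q = ?q" if "represents_form q \<phi>" for q
  proof (rule eq_matI)
    show "dim_row q = dim_row ?q" "dim_col q = dim_col ?q"
      using that by (auto simp: represents_form_def)
    fix k m assume "k < dim_row ?q" "m < dim_col ?q"
    then have km: "k < n ^ 3" "m < n ^ 3" by auto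
    have q: "q \<in> carrier_mat (n ^ 3) (n ^ 3)" using that by (simp add: represents_form_def)
    have "\<phi> (\<beta> (unit_product k) (unit_product m)) = unit_vec (n ^ 3) k \<bullet> (q *\<^sub>v unit_vec (n ^ 3) m)"
      using that km unit_product_V21 by (simp add: represents_form_def structure_vec_unit_product)
    also have "\<dots> = q $$ (k, m)"
      using q km by (simp add: mult_mat_vec_def)
    finally show "q $$ (k, m) = ?q $$ (k, m)" using km by simp
  qed
  with ex show ?thesis by blast
qed

end

end

theory Submission
  imports Defs
begin

text \<open>
  The forms \<open>q\<close> with \<open>v\<^sup>t q v = 0\<close> make up a subspace of matrices that contains \<open>q\<close> exactly when
  it contains the symmetrisation of \<open>q\<close>. Hence \<open>(x, x) \<in> As(V)\<close> says that every functional on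
  \<open>V\<^sup>3\<^sup>,\<^sup>1\<close> vanishes at \<open>\<beta>(x, x) = \<Phi>(x)\<close>. The functionals reading off a coordinate of
  \<open>t(a, b, c)\<close> separate the points of \<open>V\<^sup>3\<^sup>,\<^sup>1\<close>, so this means \<open>\<Phi>(x) = 0\<close>.
\<close>

text \<open>The kernel of the functional q -> v^t q v on square matrices, for fixed
  \<open>v\<close>. Vanishing of a family of forms at \<open>v\<close> thus becomes an inclusion of
  sets, to which span arguments apply.\<close>

definition isotropic_mats :: "nat \<Rightarrow> 'a::field vec \<Rightarrow> 'a mat set" where
  "isotropic_mats N v = {q \<in> carrier_mat N N. v \<bullet> (q *\<^sub>v v) = 0}"

lemma quadratic_form_smult:
  fixes q :: "'a::field mat"
  assumes "q \<in> carrier_mat N N" "v \<in> carrier_vec N"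
  shows "v \<bullet> ((c \<cdot>\<^sub>m q) *\<^sub>v v) = c * (v \<bullet> (q *\<^sub>v v))"
proof -
  have "(c \<cdot>\<^sub>m q) *\<^sub>v v = c \<cdot>\<^sub>v (q *\<^sub>v v)"
    using assms by (intro eq_vecI) auto
  then show ?thesis
    using assms by simp
qed

lemma quadratic_form_add:
  fixes q r :: "'a::field mat"
  assumes "q \<in> carrier_mat N N" "r \<in> carrier_mat N N" "v \<in> carrier_vec N"
  shows "v \<bullet> ((q + r) *\<^sub>v v) = v \<bullet> (q *\<^sub>v v) + v \<bullet> (r *\<^sub>v v)"
  using assms by (simp add: add_mult_distrib_mat_vec[OF assms] scalar_prod_add_distrib[of v N])

text \<open>A scalar equals its own transpose: moving \<open>q\<close> to the other factor turns the
  left side into the product of \<open>q *\<^sub>v v\<close> with \<open>v\<close>.\<close>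

lemma quadratic_form_transpose:
  fixes q :: "'a::field mat"
  assumes "q \<in> carrier_mat N N" "v \<in> carrier_vec N"
  shows "v \<bullet> (q\<^sup>T *\<^sub>v v) = v \<bullet> (q *\<^sub>v v)"
  using assms transpose_vec_mult_scalar[OF assms(1,2,2)]
  by (simp add: comm_scalar_prod[of v N])

text \<open>Both summands contribute the same value, and 2 is invertible in characteristic
  0.\<close>

lemma quadratic_form_symmetrisation:
  fixes q :: "'a::field_char_0 mat"
  assumes "q \<in> carrier_mat N N" "v \<in> carrier_vec N"
  shows "v \<bullet> (((1 / 2) \<cdot>\<^sub>m (q + q\<^sup>T)) *\<^sub>v v) = v \<bullet> (q *\<^sub>v v)"
  using assms by (subst quadratic_form_smult[of _ N])
    (auto simp: quadratic_form_add[of _ N] quadratic_form_transpose[of _ N])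

lemma submodule_isotropic_mats:
  fixes v :: "'a::field vec"
  assumes "v \<in> carrier_vec N"
  shows "submodule class_ring (isotropic_mats N v) (module_mat TYPE('a) N N)"
proof -
  interpret vectorspace class_ring "module_mat TYPE('a) N N" by (rule matrix_vs)
  have zero: "0\<^sub>m N N *\<^sub>v v = 0\<^sub>v N"
    using assms by (intro eq_vecI) auto
  show ?thesis
    by (rule submodule.intro[OF module_axioms])
      (use assms in \<open>auto simp: isotropic_mats_def matrix_vs_simps quadratic_form_smult[of _ N]
        quadratic_form_add[of _ N] zero\<close>)
qed

context based_vector_space
begin

text \<open>The span is the least subspace containing \<open>S\<close>, so isotropy need only be
  checked on generators.\<close>

lemma mat_span_subset_isotropic:
  assumes "v \<in> carrier_vec (n ^ 3)" "S \<subseteq> isotropic_mats (n ^ 3) v"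
  shows "mat_span S \<subseteq> isotropic_mats (n ^ 3) v"
proof -
  interpret M: vectorspace class_ring "module_mat TYPE('k) (n ^ 3) (n ^ 3)" by (rule matrix_vs)
  show ?thesis
    unfolding mat_span_def by (rule M.span_is_subset[OF assms(2) submodule_isotropic_mats[OF assms(1)]])
qed

lemma mat_span_superset: "S \<subseteq> carrier_mat (n ^ 3) (n ^ 3) \<Longrightarrow> S \<subseteq> mat_span S"
proof -
  interpret M: vectorspace class_ring "module_mat TYPE('k) (n ^ 3) (n ^ 3)" by (rule matrix_vs)
  show "S \<subseteq> carrier_mat (n ^ 3) (n ^ 3) \<Longrightarrow> S \<subseteq> mat_span S"
    unfolding mat_span_def by (rule M.in_own_span) (simp add: module_mat_simps)
qed

lemma mat_span_carrier:
  assumes "S \<subseteq> carrier_mat (n ^ 3) (n ^ 3)"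
  shows "mat_span S \<subseteq> carrier_mat (n ^ 3) (n ^ 3)"
proof -
  interpret M: vectorspace class_ring "module_mat TYPE('k) (n ^ 3) (n ^ 3)" by (rule matrix_vs)
  show ?thesis
    unfolding mat_span_def using M.span_is_subset2[of S] assms by (simp add: module_mat_simps)
qed

lemma q_mat_represents_form: "\<phi> \<in> V31_dual \<Longrightarrow> represents_form (q_mat \<phi>) \<phi>"
  unfolding q_mat_def by (rule theI'[OF ex1_represents_form])

lemma q_mat_carrier: "\<phi> \<in> V31_dual \<Longrightarrow> q_mat \<phi> \<in> carrier_mat (n ^ 3) (n ^ 3)"
  using q_mat_represents_form by (simp add: represents_form_def)

lemma Q_As_carrier: "Q_As \<subseteq> carrier_mat (n ^ 3) (n ^ 3)"
  unfolding Q_As_def by (rule mat_span_carrier) (auto simp: q_mat_carrier)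

lemma Q_As_sym_isotropic_iff:
  assumes v: "v \<in> carrier_vec (n ^ 3)"
  shows "Q_As_sym \<subseteq> isotropic_mats (n ^ 3) v \<longleftrightarrow> Q_As \<subseteq> isotropic_mats (n ^ 3) v"
proof -
  let ?sym = "\<lambda>q. (1 / 2) \<cdot>\<^sub>m (q + q\<^sup>T) :: 'k mat"
  have carrier: "?sym ` Q_As \<subseteq> carrier_mat (n ^ 3) (n ^ 3)"
    using Q_As_carrier by auto
  have "Q_As_sym \<subseteq> isotropic_mats (n ^ 3) v \<longleftrightarrow> ?sym ` Q_As \<subseteq> isotropic_mats (n ^ 3) v"
    unfolding Q_As_sym_def
    using mat_span_superset[OF carrier] mat_span_subset_isotropic[OF v] by blast
  \<comment> \<open>Symmetrisation preserves the value at \<open>v\<close>, so an element of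
    \<open>Q_As\<close> and its image pass or fail the test together.\<close>
  moreover have "?sym q \<in> isotropic_mats (n ^ 3) v \<longleftrightarrow> q \<in> isotropic_mats (n ^ 3) v" if "q \<in> Q_As" for q
    using that Q_As_carrier carrier quadratic_form_symmetrisation[OF _ v, of q]
    by (auto simp: isotropic_mats_def)
  ultimately show ?thesis by blast
qed

text \<open>It suffices to test the generators \<open>q_mat \<phi>\<close>; their value at the
  structure vector of \<open>x\<close> is \<phi> applied to \<open>\<beta> x x\<close>, which is
  \<open>\<Phi> x\<close>.\<close>

lemma Q_As_isotropic_iff:
  assumes x: "x \<in> V21"
  shows "Q_As \<subseteq> isotropic_mats (n ^ 3) (structure_vec x) \<longleftrightarrow> (\<forall>\<phi>\<in>V31_dual. \<phi> (\<Phi> x) = 0)"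
proof -
  have "Q_As \<subseteq> isotropic_mats (n ^ 3) (structure_vec x) \<longleftrightarrow>
      q_mat ` V31_dual \<subseteq> isotropic_mats (n ^ 3) (structure_vec x)"
    unfolding Q_As_def
    using mat_span_superset[of "q_mat ` V31_dual"] q_mat_carrier
      mat_span_subset_isotropic[OF dim_structure_vec] by blast
  moreover have "\<phi> (\<Phi> x) = structure_vec x \<bullet> (q_mat \<phi> *\<^sub>v structure_vec x)" if "\<phi> \<in> V31_dual" for \<phi>
    using q_mat_represents_form[OF that] x by (simp add: represents_form_def \<Phi>_def \<beta>_def)
  ultimately show ?thesis
    by (auto simp: isotropic_mats_def q_mat_carrier)
qed

lemma coord_functional: "(\<lambda>t. coord (t a b c) i) \<in> V31_dual"
  by (simp add: V31_dual_def coord_add coord_scale)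

lemma V31_dual_zero:
  assumes "\<phi> \<in> V31_dual"
  shows "\<phi> (\<lambda>a b c. 0) = 0"
  \<comment> \<open>The zero map is the empty linear combination.\<close>
  using dual_sum[OF assms, of "{}"] by simp

text \<open>Coordinate functionals make sense on every function \<open>t\<close>, trilinear or not,
  and a vector whose coordinates all vanish is 0.\<close>

lemma V31_dual_separates: "(\<forall>\<phi>\<in>V31_dual. \<phi> t = 0) \<longleftrightarrow> t = (\<lambda>a b c. 0)"
proof
  assume *: "\<forall>\<phi>\<in>V31_dual. \<phi> t = 0"
  show "t = (\<lambda>a b c. 0)"
  proof (intro ext)
    fix a b c
    have "coord (t a b c) i = 0" for i
      using bspec[OF * coord_functional] .
    then show "t a b c = 0"
      using sum_coord[of "t a b c"] by simp
  qed
qed (simp add: V31_dual_zero)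

lemma Alg_eq: "Alg = {x \<in> V21. (x, x) \<in> As}"
proof -
  have "(x, x) \<in> As \<longleftrightarrow> \<Phi> x = (\<lambda>a b c. 0)" if x: "x \<in> V21" for x
  proof -
    \<comment> \<open>\<open>isotropic_mats\<close> also demands the right dimensions, whereas
      \<open>As\<close> only states the vanishing.\<close>
    have "Q_As_sym \<subseteq> carrier_mat (n ^ 3) (n ^ 3)"
      unfolding Q_As_sym_def by (rule mat_span_carrier) (use Q_As_carrier in auto)
    then have "(x, x) \<in> As \<longleftrightarrow> Q_As_sym \<subseteq> isotropic_mats (n ^ 3) (structure_vec x)"
      using x by (auto simp: As_def isotropic_mats_def)
    also have "\<dots> \<longleftrightarrow> \<Phi> x = (\<lambda>a b c. 0)"
      by (simp only: Q_As_sym_isotropic_iff[OF dim_structure_vec] Q_As_isotropic_iff[OF x] V31_dual_separates)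
    finally show ?thesis .
  qed
  then show ?thesis by (auto simp: Alg_def)
qed

end

text \<open>Outside the locale, \<open>Alg\<close> and \<open>V21\<close> depend on
  \<open>scale\<close> alone, while \<open>As\<close> also takes the basis that defines the
  structure constants.\<close>

theorem proposition1p2:
  fixes scale :: "'k::field_char_0 \<Rightarrow> 'v::ab_group_add \<Rightarrow> 'v"
    and n :: nat and e :: "nat \<Rightarrow> 'v"
  assumes "based_vector_space scale n e"
  shows "based_vector_space.Alg scale =
    {x \<in> based_vector_space.V21 scale. (x, x) \<in> based_vector_space.As scale n e}"
  using assms by (rule based_vector_space.Alg_eq)

end
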